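(* Among the stochastic derivatives $\mathcal{D}_\mu$, $\mu\in\{-1,0,1\}$, reversibility of a differential equation is always preserved under the stochastic embedding associated to $\mathcal{D}_\mu$ if and only if $\mu=0$. Equivalently, $R(\mathcal{D}_\mu)=-\mathcal{D}_\mu$ if and only if $\mu=0$.
   Context: $D$ and $D_*$ are Nelson's forward and backward derivatives: $DX(t)=\lim_{h\to0^+}E[\frac{X(t+h)-X(t)}{h}\mid\mathcal{P}_t]$, $D_*X(t)=\lim_{h\to0^+}E[\frac{X(t)-X(t-h)}{h}\mid\mathcal{F}_t]$ for an increasing family $(\mathcal{P}_t)$ and a decreasing family $(\mathcal{F}_t)$ of $\sigma$-algebras. $\mathcal{D}_\mu=\frac{D+D_*}{2}+i\mu\frac{D-D_*}{2}$. The stochastic embedding associated to an operator $\delta$ replaces $\frac{d^i}{dt^i}$ by $\delta^i$ in a differential operator $\sum_i a_i\frac{d^i}{dt^i}$. A differential equation given by an operator $O\in\mathbb{R}[d/dt]$ is reversible if $O$ is invariant under the $\mathbb{R}$-linear substitution $d/dt\mapsto-d/dt$. On the stochastic side, $D,D_*$ are treated as free symbols and $R:\mathbb{C}[D,D_*]\to\mathbb{C}[D,D_*]$ is the $\mathbb{C}$-morphism with $R(D)=-D_*$, $R(D_* )=-D$; a stochastic equation $O\cdot X=0$ is reversible if and only if $R(O)\cdot X=0$. Without assuming a particular form for the underlying equation, the embedding associated to $\delta$ is said to always preserve reversibility when $R(\delta)=-\delta$. *)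

theory Defs
  imports Complex_Main "HOL-Library.Poly_Mapping" "HOL-Computational_Algebra.Polynomial"
begin

text \<open>
  \<open>\<complex>[D, D\<^sub>*]\<close> is the free associative unital algebra on two symbols: \<open>D\<close> and \<open>D\<^sub>*\<close> stand for
  operators that do not commute. It is realised as the monoid algebra, with convolution product,
  of the free monoid of words; the product of the monoid is written additively because
  \<open>Poly_Mapping\<close> expects this.
\<close>

datatype nsym = Fwd | Bwd

datatype nword = Word (letters: "nsym list")

instantiation nword :: monoid_add
begin

definition zero_nword :: nword where
  "0 = Word []"

definition plus_nword :: "nword \<Rightarrow> nword \<Rightarrow> nword" where
  "u + v = Word (letters u @ letters v)"

instance
  by standard (simp_all add: zero_nword_def plus_nword_def)

end

type_synonym nalg = "nword \<Rightarrow>\<^sub>0 complex"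

definition scal :: "complex \<Rightarrow> nalg" where
  "scal c = Poly_Mapping.single 0 c"

definition D_fwd :: nalg where
  "D_fwd = Poly_Mapping.single (Word [Fwd]) 1"

definition D_bwd :: nalg where
  "D_bwd = Poly_Mapping.single (Word [Bwd]) 1"

text \<open>The \<open>\<complex>\<close>-algebra morphism with \<open>D \<mapsto> -D\<^sub>*\<close> and \<open>D\<^sub>* \<mapsto> -D\<close>, through the
  universal property of the free algebra.\<close>

fun R_mor_sym :: "nsym \<Rightarrow> nalg" where
  "R_mor_sym Fwd = - D_bwd"
| "R_mor_sym Bwd = - D_fwd"

definition R_mor :: "nalg \<Rightarrow> nalg" where
  "R_mor f = (\<Sum>w\<in>Poly_Mapping.keys f.
     scal (Poly_Mapping.lookup f w) * prod_list (map R_mor_sym (letters w)))"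

definition stoch_deriv :: "real \<Rightarrow> nalg" where
  "stoch_deriv \<mu> = scal (1 / 2) * (D_fwd + D_bwd)
     + scal (\<i> * of_real \<mu> / 2) * (D_fwd - D_bwd)"

text \<open>
  A real polynomial \<open>O\<close> is read as the differential operator \<open>O(d/dt)\<close>; \<open>pcompose O [:0, -1:]\<close> is
  \<open>O(-d/dt)\<close>.
\<close>

definition reversible :: "real poly \<Rightarrow> bool" where
  "reversible P \<longleftrightarrow> pcompose P [:0, -1:] = P"

definition stoch_embed :: "nalg \<Rightarrow> real poly \<Rightarrow> nalg" where
  "stoch_embed \<delta> P = (\<Sum>i\<le>degree P. scal (of_real (coeff P i)) * \<delta> ^ i)"

text \<open>
  The embedding always preserves reversibility, whatever the form of the equation, when
  \<open>\<delta>\<close> behaves under \<open>R_mor\<close> as \<open>d/dt\<close> does under time reversal. The lemmas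
  \<open>always_preserves_reversibility_iff_embed\<close> and \<open>always_preserves_reversibility_reversible\<close>
  relate this to the equations themselves.
\<close>

definition always_preserves_reversibility :: "nalg \<Rightarrow> bool" where
  "always_preserves_reversibility \<delta> \<longleftrightarrow> R_mor \<delta> = - \<delta>"

lemma scal_mult: "scal (a * b) = scal a * scal b"
  by (simp add: scal_def mult_single)

lemma scal_add: "scal (a + b) = scal a + scal b"
  by (simp add: scal_def single_add)

lemma scal_0 [simp]: "scal 0 = 0" and scal_1 [simp]: "scal 1 = 1"
  by (simp_all add: scal_def)

lemma scal_uminus: "scal (- a) = - scal a"
  by (simp add: scal_def single_uminus)

lemma scal_mult_single: "scal a * Poly_Mapping.single w b = Poly_Mapping.single w (a * b)"
  by (simp add: scal_def mult_single)

lemma nalg_expand: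
  fixes f :: nalg
  shows "f = (\<Sum>w\<in>Poly_Mapping.keys f. Poly_Mapping.single w (Poly_Mapping.lookup f w))"
  by (rule poly_mapping_eqI) (simp add: lookup_sum lookup_single when_def in_keys_iff sum.delta)

lemma scal_commute: "scal c * f = f * scal c"
proof -
  have "scal c * (\<Sum>w\<in>A. Poly_Mapping.single w (h w)) = (\<Sum>w\<in>A. Poly_Mapping.single w (h w)) * scal c"
    for A and h :: "nword \<Rightarrow> complex"
    by (simp add: sum_distrib_left sum_distrib_right scal_def mult_single mult.commute)
  then show ?thesis
    by (metis nalg_expand)
qed

lemma R_mor_superset:
  assumes "finite A" "Poly_Mapping.keys f \<subseteq> A"
  shows "R_mor f = (\<Sum>w\<in>A. scal (Poly_Mapping.lookup f w) * prod_list (map R_mor_sym (letters w)))"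
  unfolding R_mor_def by (rule sum.mono_neutral_left) (use assms in \<open>auto simp: in_keys_iff\<close>)

lemma R_mor_add: "R_mor (f + g) = R_mor f + R_mor g"
proof -
  let ?A = "Poly_Mapping.keys f \<union> Poly_Mapping.keys g"
  have "Poly_Mapping.keys (f + g) \<subseteq> ?A"
    by (rule Poly_Mapping.keys_add)
  then show ?thesis
    by (simp add: R_mor_superset[of ?A] lookup_add scal_add distrib_right sum.distrib)
qed

lemma R_mor_0 [simp]: "R_mor 0 = 0"
  by (simp add: R_mor_def)

lemma R_mor_single:
  "R_mor (Poly_Mapping.single w c) = scal c * prod_list (map R_mor_sym (letters w))"
  by (subst R_mor_superset[of "{w}"]) auto

lemma R_mor_scal [simp]: "R_mor (scal c) = scal c"
  by (simp add: scal_def R_mor_single zero_nword_def)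

lemma R_mor_1 [simp]: "R_mor 1 = 1"
  using R_mor_scal[of 1] by simp

lemma R_mor_sum: "R_mor (sum h A) = (\<Sum>a\<in>A. R_mor (h a))"
  by (induction A rule: infinite_finite_induct) (simp_all add: R_mor_add)

lemma R_mor_mult: "R_mor (f * g) = R_mor f * R_mor g"
proof -
  have single: "R_mor (Poly_Mapping.single u a * Poly_Mapping.single v b)
      = R_mor (Poly_Mapping.single u a) * R_mor (Poly_Mapping.single v b)" for u v a b
  proof -
    let ?p = "\<lambda>w. prod_list (map R_mor_sym (letters w))"
    have "R_mor (Poly_Mapping.single u a * Poly_Mapping.single v b) = scal a * scal b * (?p u * ?p v)"
      by (simp add: mult_single R_mor_single plus_nword_def scal_mult)
    also have "\<dots> = scal a * (scal b * ?p u) * ?p v"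
      by (simp add: mult.assoc)
    also have "\<dots> = scal a * ?p u * (scal b * ?p v)"
      by (simp add: scal_commute[of b "?p u"] mult.assoc)
    finally show ?thesis
      by (simp add: R_mor_single)
  qed
  have "R_mor ((\<Sum>u\<in>A. Poly_Mapping.single u (p u)) * (\<Sum>v\<in>B. Poly_Mapping.single v (q v)))
      = R_mor (\<Sum>u\<in>A. Poly_Mapping.single u (p u)) * R_mor (\<Sum>v\<in>B. Poly_Mapping.single v (q v))"
    for A B and p q :: "nword \<Rightarrow> complex"
    by (simp only: sum_product R_mor_sum single)
  then show ?thesis
    by (metis nalg_expand)
qed

lemma R_mor_D_fwd [simp]: "R_mor D_fwd = - D_bwd" and R_mor_D_bwd [simp]: "R_mor D_bwd = - D_fwd"
  by (simp_all add: D_fwd_def D_bwd_def R_mor_single)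

lemma R_mor_power: "R_mor (f ^ n) = R_mor f ^ n"
  by (induction n) (simp_all add: R_mor_mult)

lemma R_mor_stoch_embed: "R_mor (stoch_embed \<delta> P) = stoch_embed (R_mor \<delta>) P"
  by (simp add: stoch_embed_def R_mor_sum R_mor_mult R_mor_power)

lemma stoch_embed_reflect: "stoch_embed \<delta> (pcompose P [:0, -1:]) = stoch_embed (- \<delta>) P"
proof -
  have power: "(- \<delta>) ^ i = scal ((- 1) ^ i) * \<delta> ^ i" for i
  proof (cases "even i")
    case True
    then show ?thesis by simp
  next
    case False
    then show ?thesis by (simp add: scal_uminus)
  qed
  have "scal (of_real ((- 1) ^ i * coeff P i)) * \<delta> ^ i = scal (of_real (coeff P i)) * (- \<delta>) ^ i" for i
    by (simp add: power scal_mult scal_commute[of "(- 1) ^ i"] mult.assoc)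
  then show ?thesis
    by (simp add: stoch_embed_def coeff_pcompose_linear degree_pcompose)
qed

lemma always_preserves_reversibility_iff_embed:
  "always_preserves_reversibility \<delta> \<longleftrightarrow>
     (\<forall>P. R_mor (stoch_embed \<delta> P) = stoch_embed \<delta> (pcompose P [:0, -1:]))"
proof
  assume "\<forall>P. R_mor (stoch_embed \<delta> P) = stoch_embed \<delta> (pcompose P [:0, -1:])"
  then have "stoch_embed (R_mor \<delta>) [:0, 1:] = stoch_embed (- \<delta>) [:0, 1:]"
    by (simp only: R_mor_stoch_embed stoch_embed_reflect)
  then show "always_preserves_reversibility \<delta>"
    by (simp add: stoch_embed_def always_preserves_reversibility_def)
qed (simp add: always_preserves_reversibility_def R_mor_stoch_embed stoch_embed_reflect)

lemma always_preserves_reversibility_reversible: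
  assumes "always_preserves_reversibility \<delta>" "reversible P"
  shows "R_mor (stoch_embed \<delta> P) = stoch_embed \<delta> P"
  using assms by (simp add: always_preserves_reversibility_iff_embed reversible_def)

end

theory Submission
  imports Defs
begin

text \<open>
  \<open>R_mor\<close> sends \<open>D\<close> to \<open>-D\<^sub>*\<close> and \<open>D\<^sub>*\<close> to \<open>-D\<close>, so it negates \<open>D + D\<^sub>*\<close> and fixes \<open>D - D\<^sub>*\<close>.
  In \<open>stoch_deriv \<mu>\<close> the symmetric half therefore changes sign as \<open>d/dt\<close> does under time
  reversal, whereas the antisymmetric half, which carries the factor \<open>\<i> \<mu>\<close>, does not. What keeps
  \<open>stoch_deriv \<mu>\<close> from being negated is twice that half (\<open>R_mor_stoch_deriv_defect\<close>), that is
  \<open>\<i> \<mu> (D - D\<^sub>*)\<close>. It vanishes only for \<open>\<mu> = 0\<close>, because \<open>D\<close> and \<open>D\<^sub>*\<close> are distinct basis words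
  of the free algebra.
\<close>

lemma R_mor_diff: "R_mor (f - g) = R_mor f - R_mor g"
  using R_mor_add[of "f - g" g] by simp

lemma R_mor_stoch_deriv_defect:
  "R_mor (stoch_deriv \<mu>) + stoch_deriv \<mu> = scal (\<i> * of_real \<mu>) * (D_fwd - D_bwd)"
proof -
  have double: "scal (\<i> * of_real \<mu>) = scal (\<i> * of_real \<mu> / 2) + scal (\<i> * of_real \<mu> / 2)"
    by (simp flip: scal_add)
  show ?thesis
    unfolding double
    by (simp add: stoch_deriv_def R_mor_add R_mor_diff R_mor_mult algebra_simps)
qed

lemma scal_mult_D_diff_eq_0_iff: "scal c * (D_fwd - D_bwd) = 0 \<longleftrightarrow> c = 0"
proof
  assume "scal c * (D_fwd - D_bwd) = 0"
  then have "Poly_Mapping.lookup (scal c * (D_fwd - D_bwd)) (Word [Fwd]) = 0"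
    by simp
  then show "c = 0"
    by (simp add: D_fwd_def D_bwd_def right_diff_distrib scal_mult_single lookup_minus lookup_single)
qed simp

lemma R_mor_stoch_deriv_eq_uminus_iff:
  "R_mor (stoch_deriv \<mu>) = - stoch_deriv \<mu> \<longleftrightarrow> \<mu> = 0"
  by (simp add: eq_neg_iff_add_eq_0 R_mor_stoch_deriv_defect scal_mult_D_diff_eq_0_iff)

theorem lemma5p3:
  fixes \<mu> :: real
  assumes "\<mu> \<in> {-1, 0, 1}"
  shows "(always_preserves_reversibility (stoch_deriv \<mu>) \<longleftrightarrow> \<mu> = 0) \<and>
         (R_mor (stoch_deriv \<mu>) = - stoch_deriv \<mu> \<longleftrightarrow> \<mu> = 0)"
  by (simp add: always_preserves_reversibility_def R_mor_stoch_deriv_eq_uminus_iff)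

end
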